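(* For every integer $n \ge 3$, $\gamma_{MB}(P_3 \square K_{1,n}) = \gamma'_{SMB}(P_3 \square K_{1,n}) = n+2$.
   Context: The Maker-Breaker domination game on a finite graph $G$ is played by Dominator and Staller, who alternately claim a previously unplayed vertex of $G$. Dominator wins as soon as his claimed vertices form a dominating set of $G$; Staller wins as soon as she claims all vertices of some closed neighborhood $N_G[v]$. The D-game is the game where Dominator moves first, the S-game where Staller moves first. $\gamma_{MB}(G)$ is the minimum number of moves Dominator needs to win the D-game when both play optimally (Dominator trying to win as fast as possible, Staller trying to delay), and $\infty$ if Dominator has no winning strategy in the D-game. $\gamma'_{SMB}(G)$ is the minimum number of moves Staller needs to win the S-game when both play optimally (Staller trying to win as fast as possible, Dominator trying to delay), and $\infty$ if Staller has no winning strategy in the S-game. $P_3$ is the path on 3 vertices, $K_{1,n}$ the star with $n$ leaves, and $\square$ the Cartesian product of graphs. *)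

theory Defs
  imports "Graph_Theory.Pair_Digraph" "HOL-Library.Extended_Nat"
begin

text \<open>
  A finite simple graph is a \<^typ>\<open>'a pair_pre_digraph\<close> satisfying \<^locale>\<open>pair_graph\<close>: each edge is
  represented by its two opposite arcs.
\<close>

definition path_graph :: "nat \<Rightarrow> nat pair_pre_digraph" where
  "path_graph m = \<lparr> pverts = {0..<m},
     parcs = {(i, j). i < m \<and> j < m \<and> (j = Suc i \<or> i = Suc j)} \<rparr>"

text \<open>The star $K_{1,n}$ has centre \<open>0\<close> and leaves \<open>1, \<dots>, n\<close>.\<close>

definition star_graph :: "nat \<Rightarrow> nat pair_pre_digraph" where
  "star_graph n = \<lparr> pverts = {0..n},
     parcs = {(i, j). i \<le> n \<and> j \<le> n \<and> (i = 0 \<longleftrightarrow> j \<noteq> 0)} \<rparr>"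

definition cartesian_product ::
  "'a pair_pre_digraph \<Rightarrow> 'b pair_pre_digraph \<Rightarrow> ('a \<times> 'b) pair_pre_digraph"  (infixl "\<box>" 70) where
  "G \<box> H = \<lparr> pverts = pverts G \<times> pverts H,
     parcs = {((a, b), (c, d)).
       (a = c \<and> a \<in> pverts G \<and> (b, d) \<in> parcs H) \<or>
       (b = d \<and> b \<in> pverts H \<and> (a, c) \<in> parcs G)} \<rparr>"

lemma pair_graph_path_graph: "pair_graph (path_graph m)"
proof
  show "finite (parcs (path_graph m))"
    by (rule finite_subset[of _ "{0..<m} \<times> {0..<m}"]) (auto simp: path_graph_def)
  show "symmetric (path_graph m)"
    by (auto simp: symmetric_def sym_def path_graph_def)
qed (auto simp: path_graph_def)

lemma pair_graph_star_graph: "pair_graph (star_graph n)"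
proof
  show "finite (parcs (star_graph n))"
    by (rule finite_subset[of _ "{0..n} \<times> {0..n}"]) (auto simp: star_graph_def)
  show "symmetric (star_graph n)"
    by (auto simp: symmetric_def sym_def star_graph_def)
qed (auto simp: star_graph_def)

lemma pair_graph_cartesian_product:
  assumes "pair_graph G" "pair_graph H"
  shows "pair_graph (G \<box> H)"
proof -
  interpret G: pair_graph G by fact
  interpret H: pair_graph H by fact
  have symG: "(b, a) \<in> parcs G" if "(a, b) \<in> parcs G" for a b
    using G.pair_sym_arcs that by (auto simp: symmetric_def sym_def)
  have symH: "(b, a) \<in> parcs H" if "(a, b) \<in> parcs H" for a b
    using H.pair_sym_arcs that by (auto simp: symmetric_def sym_def)
  have fin: "finite (pverts (G \<box> H))"
    by (simp add: cartesian_product_def G.pair_finite_verts H.pair_finite_verts)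
  have sub: "parcs (G \<box> H) \<subseteq> pverts (G \<box> H) \<times> pverts (G \<box> H)"
    by (auto simp: cartesian_product_def dest: G.wellformed' H.wellformed')
  show ?thesis
  proof
    show "finite (parcs (G \<box> H))"
      using fin sub by (meson finite_SigmaI finite_subset)
    show "symmetric (G \<box> H)"
      by (auto simp: symmetric_def sym_def cartesian_product_def intro: symG symH)
    show "fst e \<noteq> snd e" if "e \<in> parcs (G \<box> H)" for e
      using that by (auto simp: cartesian_product_def dest: G.pair_no_loops H.pair_no_loops)
  qed (use fin sub in auto)
qed

definition closed_neighborhood :: "'a pair_pre_digraph \<Rightarrow> 'a \<Rightarrow> 'a set" where
  "closed_neighborhood G v = insert v {u \<in> pverts G. (v, u) \<in> parcs G}"

definition dominating_set :: "'a pair_pre_digraph \<Rightarrow> 'a set \<Rightarrow> bool" where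
  "dominating_set G D \<longleftrightarrow>
     D \<subseteq> pverts G \<and> (\<forall>v \<in> pverts G. v \<in> D \<or> (\<exists>u \<in> D. (u, v) \<in> parcs G))"

definition claims_closed_neighborhood :: "'a pair_pre_digraph \<Rightarrow> 'a set \<Rightarrow> bool" where
  "claims_closed_neighborhood G S \<longleftrightarrow> (\<exists>v \<in> pverts G. closed_neighborhood G v \<subseteq> S)"

definition unplayed :: "'a pair_pre_digraph \<Rightarrow> 'a set \<Rightarrow> 'a set \<Rightarrow> 'a set" where
  "unplayed G D S = pverts G - (D \<union> S)"

datatype player = Dominator | Staller

text \<open>
  A position consists of the player \<open>p\<close> to move and the sets \<open>D\<close> and \<open>S\<close> of vertices claimed so far
  by Dominator and by Staller. \<open>dominator_wins G p k D S\<close> says that from this position Dominator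
  can force a win using at most \<open>k\<close> further moves of his own, whatever Staller does;
  \<open>staller_wins G p k D S\<close> says the same for Staller, counting her moves. The game ends as soon as
  one of the players has won. If the opponent of the player whose win is asserted has to move on a
  full board, the universal premise is vacuous, but then that player has already won, by lemma
  \<open>full_board\<close> below.
\<close>

inductive dominator_wins ::
  "'a pair_pre_digraph \<Rightarrow> player \<Rightarrow> nat \<Rightarrow> 'a set \<Rightarrow> 'a set \<Rightarrow> bool" for G where
  won: "dominating_set G D \<Longrightarrow> dominator_wins G p k D S"
| dominator_move: "\<lbrakk>\<not> claims_closed_neighborhood G S; v \<in> unplayed G D S;
    dominator_wins G Staller k (insert v D) S\<rbrakk> \<Longrightarrow> dominator_wins G Dominator (Suc k) D S"
| staller_move: "\<lbrakk>\<not> claims_closed_neighborhood G S;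
    \<forall>v \<in> unplayed G D S. dominator_wins G Dominator k D (insert v S)\<rbrakk>
    \<Longrightarrow> dominator_wins G Staller k D S"

inductive staller_wins ::
  "'a pair_pre_digraph \<Rightarrow> player \<Rightarrow> nat \<Rightarrow> 'a set \<Rightarrow> 'a set \<Rightarrow> bool" for G where
  won: "claims_closed_neighborhood G S \<Longrightarrow> staller_wins G p k D S"
| staller_move: "\<lbrakk>\<not> dominating_set G D; v \<in> unplayed G D S;
    staller_wins G Dominator k D (insert v S)\<rbrakk> \<Longrightarrow> staller_wins G Staller (Suc k) D S"
| dominator_move: "\<lbrakk>\<not> dominating_set G D;
    \<forall>v \<in> unplayed G D S. staller_wins G Staller k (insert v D) S\<rbrakk>
    \<Longrightarrow> staller_wins G Dominator k D S"

lemma full_board: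
  assumes "pair_graph G" "D \<subseteq> pverts G" "D \<inter> S = {}" "unplayed G D S = {}"
  shows "claims_closed_neighborhood G S \<longleftrightarrow> \<not> dominating_set G D"
proof -
  interpret pair_graph G by fact
  have sym: "(u, v) \<in> parcs G \<longleftrightarrow> (v, u) \<in> parcs G" for u v
    using pair_sym_arcs by (auto simp: symmetric_def sym_def)
  have inS: "u \<in> S \<longleftrightarrow> u \<notin> D" if "u \<in> pverts G" for u
    using assms that by (auto simp: unplayed_def)
  have "closed_neighborhood G v \<subseteq> S \<longleftrightarrow> \<not> (v \<in> D \<or> (\<exists>u \<in> D. (u, v) \<in> parcs G))"
    if "v \<in> pverts G" for v
    unfolding closed_neighborhood_def using that assms(2) inS sym by blast
  then show ?thesis
    using assms(2) by (auto simp: claims_closed_neighborhood_def dominating_set_def)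
qed

text \<open>Both numbers are \<open>\<infinity>\<close>, the infimum of the empty set, if there is no winning strategy.\<close>

definition gamma_MB :: "'a pair_pre_digraph \<Rightarrow> enat" where
  "gamma_MB G = Inf {enat k | k. dominator_wins G Dominator k {} {}}"

definition gamma_SMB' :: "'a pair_pre_digraph \<Rightarrow> enat" where
  "gamma_SMB' G = Inf {enat k | k. staller_wins G Staller k {} {}}"

end

theory Submission
  imports Defs
begin

text \<open>
  Write \<open>(r, i)\<close> for the vertices, with \<open>r = 1\<close> the centre of the path and \<open>i = 0\<close> the centre of the star.

  Moving first, Dominator takes \<open>(0, 0)\<close> and then follows the pairs \<open>{(1, i), (2, i)}\<close> for
  \<open>i = 0, \<dots>, n\<close>. Conversely, Staller can make him spend one move per column \<open>i \<ge> 1\<close> besides his first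
  move, and one further move: either she blocks the closed neighbourhood of \<open>(p, 0)\<close> by forcing him
  into \<open>(1, j)\<close> whenever she takes \<open>(p, j)\<close>, or she obtains both \<open>(0, 0)\<close> and \<open>(2, 0)\<close>; then an untouched
  column \<open>j\<close> gives her a double threat at \<open>(1, j)\<close>, and three moves of Dominator can only touch all
  columns if \<open>n = 3\<close>.

  Moving first, Staller takes \<open>(0, 0)\<close>, threatening to take \<open>(2, 0)\<close>. If Dominator takes \<open>(2, 0)\<close>, she plays
  \<open>(0, 1), \<dots>, (0, n)\<close>, each forcing Dominator into the middle of its column, and ends with \<open>(1, 0)\<close>.
  Conversely, the closed neighbourhoods of the three vertices with \<open>i = 0\<close> are too large to be claimed in
  \<open>n + 1\<close> moves, and Dominator defends the others by a pairing strategy.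
\<close>

section \<open>Preliminaries on least move numbers and closed neighbourhoods\<close>

lemma Inf_enat_eq_least:
  assumes "P m" "\<And>k. k < m \<Longrightarrow> \<not> P k"
  shows "Inf {enat k | k. P k} = enat m"
proof (rule antisym)
  show "Inf {enat k | k. P k} \<le> enat m"
    using assms(1) by (intro Inf_lower) auto
  show "enat m \<le> Inf {enat k | k. P k}"
    using assms(2) by (intro Inf_greatest) (auto simp: not_less[symmetric])
qed

text \<open>By symmetry of the arcs, Dominator has to hit exactly the sets that Staller tries to
  fill.\<close>

lemma dominating_set_iff:
  assumes "pair_graph G"
  shows "dominating_set G D \<longleftrightarrow>
    D \<subseteq> pverts G \<and> (\<forall>v\<in>pverts G. closed_neighborhood G v \<inter> D \<noteq> {})"
proof -
  interpret pair_graph G by fact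
  have "(u, v) \<in> parcs G \<longleftrightarrow> (v, u) \<in> parcs G" for u v
    using pair_sym_arcs by (auto simp: symmetric_def sym_def)
  then show ?thesis
    unfolding dominating_set_def closed_neighborhood_def by blast
qed

lemma closed_neighborhood_subset:
  "v \<in> pverts G \<Longrightarrow> closed_neighborhood G v \<subseteq> pverts G"
  by (auto simp: closed_neighborhood_def)

section \<open>Pairing strategies\<close>

text \<open>Dominator answers a move inside a member of \<open>T\<close> with another vertex of that
  member, and any other move inside an arbitrary member. Each round uses up one member, and the
  neighbourhoods relying on it become dominated. The condition on \<open>{v}\<close> says that
  members have at least two elements.\<close>

lemma dominator_wins_pairing:
  assumes "pair_graph G" "finite T" "D \<subseteq> pverts G" "D \<inter> S = {}"
    and "\<And>t. t \<in> T \<Longrightarrow> t \<subseteq> unplayed G D S"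
    and "\<And>t v. t \<in> T \<Longrightarrow> \<not> t \<subseteq> {v}"
    and "disjoint T"
    and "\<And>v. v \<in> pverts G \<Longrightarrow>
      closed_neighborhood G v \<inter> D \<noteq> {} \<or> (\<exists>t\<in>T. t \<subseteq> closed_neighborhood G v)"
  shows "dominator_wins G Staller (card T) D S"
  using assms(2-)
proof (induction "card T" arbitrary: T D S)
  case 0
  then have "T = {}"
    by simp
  then have "dominating_set G D"
    using 0(3,8) by (simp add: dominating_set_iff[OF assms(1)])
  then show ?case by (rule dominator_wins.won)
next
  case (Suc m)
  \<comment> \<open>A neighbourhood inside \<open>insert v S\<close> would miss \<open>D\<close> and
    hence contain a member of \<open>T\<close>; being unplayed, that member would lie inside
    \<open>{v}\<close>.\<close>
  have unclaimed: "\<not> claims_closed_neighborhood G S'" if sub: "S' \<subseteq> insert v S" and v: "v \<notin> D" for v S'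
  proof
    assume "claims_closed_neighborhood G S'"
    then obtain w where w: "w \<in> pverts G" "closed_neighborhood G w \<subseteq> insert v S"
      using sub by (auto simp: claims_closed_neighborhood_def)
    then have "closed_neighborhood G w \<inter> D = {}"
      using Suc.prems(3) v by auto
    then obtain t where t: "t \<in> T" "t \<subseteq> insert v S"
      using Suc.prems(7)[OF w(1)] w(2) by (metis order_trans)
    then show False
      using Suc.prems(4)[OF t(1)] Suc.prems(5)[OF t(1), of v] t(2) by (auto simp: unplayed_def)
  qed
  show ?case
  proof (rule dominator_wins.staller_move)
    obtain t where t: "t \<in> T"
      using Suc.hyps(2) by (metis card.empty equals0I nat.distinct(1))
    then obtain v where "v \<in> t"
      using Suc.prems(5)[OF t] by blast
    then show "\<not> claims_closed_neighborhood G S"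
      using unclaimed[of S v] Suc.prems(4)[OF t] by (auto simp: unplayed_def)
    show "\<forall>v\<in>unplayed G D S. dominator_wins G Dominator (card T) D (insert v S)"
    proof
      fix v assume v: "v \<in> unplayed G D S"
      \<comment> \<open>A move of Staller outside all members still uses up one of them, so the
        count drops by exactly one per round.\<close>
      obtain t where t: "t \<in> T" "v \<in> \<Union>T \<longrightarrow> v \<in> t"
      proof (cases "v \<in> \<Union>T")
        case False
        have "T \<noteq> {}"
          using Suc.hyps(2) by auto
        then show ?thesis
          using that False by blast
      qed blast
      then obtain u where u: "u \<in> t" "u \<noteq> v"
        using Suc.prems(5)[of t v] by blast
      have disj: "s \<inter> t = {}" if "s \<in> T - {t}" for s
        using Suc.prems(6) t(1) that by (auto simp: disjoint_def)
      have card: "card (T - {t}) = m"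
        using Suc.hyps(2) t(1) Suc.prems(1) by simp
      have "dominator_wins G Staller (card (T - {t})) (insert u D) (insert v S)"
      proof (rule Suc.hyps(1))
        show "insert u D \<subseteq> pverts G"
          using Suc.prems(2) Suc.prems(4)[OF t(1)] u by (auto simp: unplayed_def)
        show "insert u D \<inter> insert v S = {}"
          using Suc.prems(3) Suc.prems(4)[OF t(1)] u v by (auto simp: unplayed_def)
        show "s \<subseteq> unplayed G (insert u D) (insert v S)"
          if "s \<in> T - {t}" for s
        proof -
          have "s \<in> T" "v \<notin> s" "u \<notin> s"
            using that disj[OF that] t u(1) by blast+
          then show ?thesis
            using Suc.prems(4)[of s] by (auto simp: unplayed_def)
        qed
        show "disjoint (T - {t})"
          using Suc.prems(6) by (auto simp: disjoint_def)
        show "closed_neighborhood G w \<inter> insert u D \<noteq> {} \<or>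
            (\<exists>s\<in>T - {t}. s \<subseteq> closed_neighborhood G w)" if "w \<in> pverts G" for w
          using Suc.prems(7)[OF that] u by blast
      qed (use card Suc.prems(1,5) in auto)
      then show "dominator_wins G Dominator (card T) D (insert v S)"
        unfolding Suc.hyps(2)[symmetric] card
        using Suc.prems(4)[OF t(1)] u unclaimed[of "insert v S" v] v
        by (intro dominator_wins.dominator_move[of _ _ u]) (auto simp: unplayed_def)
    qed
  qed
qed

text \<open>The pairing reply again, combined with a race: a neighbourhood is also safe while more
  than \<open>k\<close> of its vertices are missing from \<open>S\<close>, since each of Staller's
  \<open>k\<close> moves lowers that number by at most one.\<close>

lemma not_staller_wins_pairing:
  assumes "pair_graph G" "D \<subseteq> pverts G" "D \<inter> S = {}"
    and "\<And>t. t \<in> T \<Longrightarrow> t \<subseteq> unplayed G D S"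
    and "\<And>t v. t \<in> T \<Longrightarrow> \<not> t \<subseteq> {v}"
    and "disjoint T"
    and "\<And>v. v \<in> pverts G \<Longrightarrow> closed_neighborhood G v \<inter> D \<noteq> {} \<or>
      (\<exists>t\<in>T. t \<subseteq> closed_neighborhood G v) \<or> k < card (closed_neighborhood G v - S)"
  shows "\<not> staller_wins G Staller k D S"
  using assms(2-)
proof (induction k arbitrary: D S T)
  case 0
  show ?case
  proof
    assume "staller_wins G Staller 0 D S"
    then obtain w where w: "w \<in> pverts G" "closed_neighborhood G w \<subseteq> S"
      by cases (auto simp: claims_closed_neighborhood_def)
    then have "card (closed_neighborhood G w - S) = 0" "closed_neighborhood G w \<inter> D = {}"
      using 0(2) by (auto simp: Diff_eq_empty_iff[THEN iffD2])
    then obtain t where "t \<in> T" "t \<subseteq> S"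
      using 0(6)[OF w(1)] w(2) by (metis less_irrefl order_trans)
    then show False
      \<comment> \<open>Being unplayed and inside \<open>S\<close>, \<open>t\<close> is empty; any
        value in place of \<open>undefined\<close> would give the contradiction.\<close>
      using 0(3)[of t] 0(4)[of t undefined] by (auto simp: unplayed_def)
  qed
next
  case (Suc k)
  have unclaimed: "\<not> claims_closed_neighborhood G S'" if sub: "S' \<subseteq> insert v S" and v: "v \<notin> D" for v S'
  proof
    assume "claims_closed_neighborhood G S'"
    then obtain w where w: "w \<in> pverts G" "closed_neighborhood G w \<subseteq> insert v S"
      using sub by (auto simp: claims_closed_neighborhood_def)
    then have "closed_neighborhood G w \<inter> D = {}"
      using Suc.prems(2) v by auto
    moreover have "closed_neighborhood G w - S \<subseteq> {v}"
      using w(2) by blast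
    then have "\<not> Suc k < card (closed_neighborhood G w - S)"
      using card_mono[of "{v}" "closed_neighborhood G w - S"] by simp
    ultimately obtain t where t: "t \<in> T" "t \<subseteq> insert v S"
      using Suc.prems(6)[OF w(1)] w(2) by (metis order_trans)
    then show False
      using Suc.prems(3)[OF t(1)] Suc.prems(4)[OF t(1), of v] t(2) by (auto simp: unplayed_def)
  qed
  show ?case
  proof
    assume "staller_wins G Staller (Suc k) D S"
    then obtain v where v: "v \<in> unplayed G D S" "staller_wins G Dominator k D (insert v S)"
    proof cases
      case won
      then obtain v where "v \<in> S"
        by (auto simp: claims_closed_neighborhood_def closed_neighborhood_def)
      then show ?thesis
        using unclaimed[of S v] won Suc.prems(2) by blast
    qed auto
    then have "v \<notin> D" by (auto simp: unplayed_def)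
    then have nclaim: "\<not> claims_closed_neighborhood G (insert v S)"
      using unclaimed[of "insert v S" v] by auto
    from v(2) have ndom: "\<not> dominating_set G D"
      and reply: "\<forall>u\<in>unplayed G D (insert v S). staller_wins G Staller k (insert u D) (insert v S)"
      using nclaim by (cases; simp)+
    \<comment> \<open>On a full board one of the players would have won, so Dominator has a reply
      even if \<open>v\<close> lies outside all pairs.\<close>
    have "unplayed G D (insert v S) \<noteq> {}"
      using full_board[OF assms(1), of D "insert v S"] ndom nclaim Suc.prems(1,2) \<open>v \<notin> D\<close>
      by auto
    then obtain u where u: "u \<in> unplayed G D (insert v S)"
      and uT: "\<And>t. t \<in> T \<Longrightarrow> v \<in> t \<Longrightarrow> u \<in> t"
    proof (cases "v \<in> \<Union>T")
      case True
      then obtain t where t: "t \<in> T" "v \<in> t" by blast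
      then obtain u where u: "u \<in> t" "u \<noteq> v"
        using Suc.prems(4)[of t v] by blast
      have "s = t" if "s \<in> T" "v \<in> s" for s
        using Suc.prems(5) t that by (auto simp: disjoint_def)
      moreover have "u \<in> unplayed G D (insert v S)"
        using Suc.prems(3)[OF t(1)] u by (auto simp: unplayed_def)
      ultimately show ?thesis
        using that u(1) by blast
    qed blast
    \<comment> \<open>Members containing \<open>u\<close> are dropped, as the neighbourhoods relying
      on them are now dominated. Every member containing \<open>v\<close> is among them, so the
      others are still unplayed.\<close>
    have "\<not> staller_wins G Staller k (insert u D) (insert v S)"
    proof (rule Suc.IH[of _ _ "{t \<in> T. u \<notin> t}"])
      show "insert u D \<subseteq> pverts G" "insert u D \<inter> insert v S = {}"
        using Suc.prems(1,2) u \<open>v \<notin> D\<close> by (auto simp: unplayed_def)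
      show "t \<subseteq> unplayed G (insert u D) (insert v S)"
        if "t \<in> {t \<in> T. u \<notin> t}" for t
        using Suc.prems(3)[of t] uT[of t] that by (auto simp: unplayed_def)
      show "\<not> t \<subseteq> {v}" if "t \<in> {t \<in> T. u \<notin> t}" for t v
        using Suc.prems(4)[of t v] that by blast
      show "disjoint {t \<in> T. u \<notin> t}"
        using Suc.prems(5) by (auto simp: disjoint_def)
      show "closed_neighborhood G w \<inter> insert u D \<noteq> {} \<or>
          (\<exists>t\<in>{t \<in> T. u \<notin> t}. t \<subseteq> closed_neighborhood G w) \<or>
          k < card (closed_neighborhood G w - insert v S)" if "w \<in> pverts G" for w
      proof -
        have "card (closed_neighborhood G w - S) - 1 \<le> card (closed_neighborhood G w - S - {v})"
          by (simp add: card_Diff_singleton_if)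
        moreover have "closed_neighborhood G w - S - {v} = closed_neighborhood G w - insert v S"
          by blast
        ultimately have "Suc k < card (closed_neighborhood G w - S) \<Longrightarrow>
            k < card (closed_neighborhood G w - insert v S)"
          by simp
        then show ?thesis
          using Suc.prems(6)[OF that] by blast
      qed
    qed
    then show False
      using reply u by blast
  qed
qed

section \<open>Lower bounds on the number of moves of Dominator\<close>

text \<open>Holds for every \<open>m\<close> if Dominator has no winning strategy at all.\<close>

definition dominator_needs ::
  "'a pair_pre_digraph \<Rightarrow> player \<Rightarrow> nat \<Rightarrow> 'a set \<Rightarrow> 'a set \<Rightarrow> bool" where
  "dominator_needs G p m D S \<longleftrightarrow> (\<forall>k<m. \<not> dominator_wins G p k D S)"

lemma dominator_needs_mono:
  "dominator_needs G p m D S \<Longrightarrow> m' \<le> m \<Longrightarrow> dominator_needs G p m' D S"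
  by (auto simp: dominator_needs_def)

lemma not_dominating_setI:
  assumes "pair_graph G" "v \<in> pverts G" "closed_neighborhood G v \<inter> D = {}"
  shows "\<not> dominating_set G D"
  using assms by (auto simp: dominating_set_iff)

text \<open>The game is lost for Dominator, so every \<open>m\<close> is a lower bound.\<close>

lemma dominator_needs_claimed:
  assumes "pair_graph G" "v \<in> pverts G" "closed_neighborhood G v \<inter> D = {}"
    and "closed_neighborhood G v \<subseteq> S"
  shows "dominator_needs G p m D S"
proof -
  have "claims_closed_neighborhood G S"
    using assms by (auto simp: claims_closed_neighborhood_def)
  then show ?thesis
    using not_dominating_setI[OF assms(1-3)]
    by (auto simp: dominator_needs_def elim: dominator_wins.cases)
qed

text \<open>The undominated \<open>v\<close> certifies that Dominator has not won yet, so that a win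
  must come from a move rule. The next two rules use the same certificate.\<close>

lemma dominator_needs_staller_move:
  assumes "pair_graph G" "v \<in> pverts G" "closed_neighborhood G v \<inter> D = {}"
    and "u \<in> unplayed G D S" "dominator_needs G Dominator m D (insert u S)"
  shows "dominator_needs G Staller m D S"
  using assms(4,5) not_dominating_setI[OF assms(1-3)]
  unfolding dominator_needs_def by (blast elim: dominator_wins.cases)

lemma dominator_needs_dominator_move:
  assumes "pair_graph G" "v \<in> pverts G" "closed_neighborhood G v \<inter> D = {}"
    and "\<And>u. u \<in> unplayed G D S \<Longrightarrow> dominator_needs G Staller m (insert u D) S"
  shows "dominator_needs G Dominator (Suc m) D S"
  unfolding dominator_needs_def
proof (intro allI impI notI)
  fix k assume k: "k < Suc m" "dominator_wins G Dominator k D S"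
  from k(2) show False
    by cases (use k(1) assms(4) not_dominating_setI[OF assms(1-3)]
        in \<open>auto simp: dominator_needs_def\<close>)
qed

text \<open>After \<open>u\<close>, only \<open>c\<close> can be missing from the neighbourhood of
  \<open>v\<close>, so Dominator must spend a move on \<open>c\<close> or lose. If \<open>c\<close>
  is not unplayed, Staller's \<open>u\<close> already completes the neighbourhood.\<close>

lemma dominator_needs_threat:
  assumes "pair_graph G" "v \<in> pverts G" "closed_neighborhood G v \<inter> D = {}"
    and "closed_neighborhood G v \<subseteq> insert c (insert u S)"
    and "u \<in> unplayed G D S" "c \<noteq> u"
    and "c \<in> unplayed G D S \<Longrightarrow> dominator_needs G Staller m (insert c D) (insert u S)"
  shows "dominator_needs G Staller (Suc m) D S"
proof (rule dominator_needs_staller_move[OF assms(1-3,5)])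
  show "dominator_needs G Dominator (Suc m) D (insert u S)"
  proof (rule dominator_needs_dominator_move[OF assms(1-3)])
    fix w assume w: "w \<in> unplayed G D (insert u S)"
    show "dominator_needs G Staller m (insert w D) (insert u S)"
    proof (cases "w = c")
      case True
      then show ?thesis using assms(7) w by (auto simp: unplayed_def)
    next
      case False
      then have v: "closed_neighborhood G v \<inter> insert w D = {}"
        using assms(3,4) w by (auto simp: unplayed_def)
      show ?thesis
      proof (cases "c \<in> S")
        case True
        then show ?thesis
          using assms(4) by (intro dominator_needs_claimed[OF assms(1,2) v]) auto
      next
        case cS: False
        show ?thesis
        proof (cases "c \<in> closed_neighborhood G v")
          case True
          have "c \<in> unplayed G (insert w D) (insert u S)"
            using True False cS assms(3,6) closed_neighborhood_subset[OF assms(2)]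
            by (auto simp: unplayed_def)
          then show ?thesis
            by (rule dominator_needs_staller_move[OF assms(1,2) v])
              (rule dominator_needs_claimed[OF assms(1,2) v], use assms(4) in auto)
        next
          case False
          then show ?thesis
            using assms(4) by (intro dominator_needs_claimed[OF assms(1,2) v]) auto
        qed
      qed
    qed
  qed
qed

text \<open>A counting bound: outside \<open>S\<close> the neighbourhoods are pairwise disjoint, so
  one move of Dominator hits at most one of them, and none is hit yet.\<close>

lemma dominator_needs_disjoint:
  assumes "pair_graph G" "finite F" "F \<subseteq> pverts G"
    and "\<And>v. v \<in> F \<Longrightarrow> closed_neighborhood G v \<inter> D = {}"
    and "\<And>v w. v \<in> F \<Longrightarrow> w \<in> F \<Longrightarrow> v \<noteq> w \<Longrightarrow>
      closed_neighborhood G v \<inter> closed_neighborhood G w \<subseteq> S"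
  shows "dominator_needs G p (card F) D S"
proof -
  have "card F \<le> k" if "dominator_wins G p k D S" for k
    using that assms(2-)
  proof (induction arbitrary: F rule: dominator_wins.induct)
    case (won D p k S)
    then have "F = {}"
      using not_dominating_setI[OF assms(1), of _ D] by blast
    then show ?case by simp
  next
    case (dominator_move S u D k)
    let ?F = "{v \<in> F. u \<notin> closed_neighborhood G v}"
    have "card ?F \<le> k"
      by (rule dominator_move.IH) (use dominator_move.prems in auto)
    \<comment> \<open>Two members hit by \<open>u\<close> would have \<open>u\<close> in common,
      which would put the unplayed \<open>u\<close> into \<open>S\<close>.\<close>
    moreover have "card (F - ?F) \<le> 1"
    proof (subst card_le_Suc0_iff_eq[folded One_nat_def])
      show "\<forall>a1\<in>F - ?F. \<forall>a2\<in>F - ?F. a1 = a2"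
        using dominator_move.prems(4) dominator_move.hyps(2) by (auto simp: unplayed_def)
    qed (use dominator_move.prems(1) in auto)
    moreover have "card F = card ?F + card (F - ?F)"
      using dominator_move.prems(1) by (subst card_Un_disjoint[symmetric]) (auto intro: arg_cong[of _ _ card])
    ultimately show ?case by simp
  next
    case (staller_move S D k)
    show ?case
    proof (cases "F = {}")
      case False
      then obtain v where v: "v \<in> F" by blast
      \<comment> \<open>The induction hypothesis needs an actual move of Staller; a free vertex is
        found in the neighbourhood of \<open>v\<close>, which misses \<open>D\<close> and is not
        filled by \<open>S\<close>.\<close>
      have "\<not> closed_neighborhood G v \<subseteq> S"
        using v staller_move.prems(2) staller_move.hyps by (auto simp: claims_closed_neighborhood_def)
      then obtain u where u: "u \<in> unplayed G D S"
        using v staller_move.prems(2,3) closed_neighborhood_subset[of v G]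
        by (fastforce simp: unplayed_def)
      show ?thesis
        by (rule staller_move.IH[THEN bspec, OF u, THEN conjunct2, rule_format])
          (use staller_move.prems in blast)+
    qed simp
  qed
  then show ?thesis
    by (auto simp: dominator_needs_def not_less[symmetric])
qed

section \<open>The game on the product of a path and a star\<close>

abbreviation grid :: "nat \<Rightarrow> (nat \<times> nat) pair_pre_digraph" where
  "grid n \<equiv> path_graph 3 \<box> star_graph n"

lemma pair_graph_grid: "pair_graph (grid n)"
  by (intro pair_graph_cartesian_product pair_graph_path_graph pair_graph_star_graph)

lemma grid_verts: "pverts (grid n) = {..2} \<times> {..n}"
  by (auto simp: cartesian_product_def path_graph_def star_graph_def)

lemma nbhd_outer:
  assumes "r = 0 \<or> r = 2" "0 < i" "i \<le> n"
  shows "closed_neighborhood (grid n) (r, i) = {(r, i), (1, i), (r, 0)}"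
  using assms
  by (auto simp: closed_neighborhood_def cartesian_product_def path_graph_def star_graph_def)

lemma nbhd_middle:
  assumes "0 < i" "i \<le> n"
  shows "closed_neighborhood (grid n) (1, i) = {(0, i), (1, i), (2, i), (1, 0)}"
  using assms
  by (auto simp: closed_neighborhood_def cartesian_product_def path_graph_def star_graph_def)

lemma nbhd_outer_center:
  assumes "r = 0 \<or> r = 2"
  shows "closed_neighborhood (grid n) (r, 0) = insert (1, 0) ({r} \<times> {..n})"
  using assms
  by (auto simp: closed_neighborhood_def cartesian_product_def path_graph_def star_graph_def)

lemma nbhd_center:
  "closed_neighborhood (grid n) (1, 0) = {(0, 0), (2, 0)} \<union> {1} \<times> {..n}"
  by (auto simp: closed_neighborhood_def cartesian_product_def path_graph_def star_graph_def)

lemmas nbhds = nbhd_outer nbhd_middle nbhd_outer_center nbhd_center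
  nbhd_middle[unfolded One_nat_def] nbhd_center[unfolded One_nat_def]

lemma grid_vertex_cases:
  assumes "v \<in> pverts (grid n)"
  obtains (outer) r i where "v = (r, i)" "r = 0 \<or> r = 2" "0 < i" "i \<le> n"
  | (middle) i where "v = (1, i)" "0 < i" "i \<le> n"
  | (outer_center) r where "v = (r, 0)" "r = 0 \<or> r = 2"
  | (center) "v = (1, 0)"
proof -
  obtain r i where v: "v = (r, i)" "r \<le> 2" "i \<le> n"
    using assms by (auto simp: grid_verts)
  then have "r = 0 \<or> r = 2 \<or> r = 1"
    by linarith
  with v that show thesis
    by (cases "i = 0") auto
qed

subsection \<open>Upper bounds\<close>

text \<open>\<open>(0, 0)\<close> hits the neighbourhoods of row 0 and of \<open>(1, 0)\<close>;
  each of the others contains the pair of its own column. There are n + 1 pairs besides the first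
  move.\<close>

lemma dominator_wins_grid: "dominator_wins (grid n) Dominator (n + 2) {} {}"
proof -
  let ?T = "(\<lambda>i. {(1, i), (2, i)}) ` {..n} :: (nat \<times> nat) set set"
  have inj: "inj_on (\<lambda>i. {(1, i), (2, i)} :: (nat \<times> nat) set) {..n}"
    by (auto simp: inj_on_def doubleton_eq_iff)
  have "dominator_wins (grid n) Staller (card ?T) {(0, 0)} {}"
  proof (rule dominator_wins_pairing[OF pair_graph_grid])
    show "disjoint ?T"
      by (auto simp: disjoint_def)
    show "closed_neighborhood (grid n) v \<inter> {(0, 0)} \<noteq> {} \<or>
        (\<exists>t\<in>?T. t \<subseteq> closed_neighborhood (grid n) v)" if "v \<in> pverts (grid n)" for v
      using that by (cases rule: grid_vertex_cases) (auto simp: nbhds)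
    show "t \<subseteq> unplayed (grid n) {(0, 0)} {}" if "t \<in> ?T" for t
      using that by (auto simp: grid_verts unplayed_def)
    show "\<not> t \<subseteq> {v}" if "t \<in> ?T" for t v
      using that by fastforce
  qed (auto simp: grid_verts)
  moreover have "card ?T = n + 1"
    by (subst card_image[OF inj]) simp
  ultimately have "dominator_wins (grid n) Staller (n + 1) {(0, 0)} {}"
    by (simp only:)
  then have "dominator_wins (grid n) Dominator (Suc (n + 1)) {} {}"
    by (intro dominator_wins.dominator_move[of _ _ "(0, 0)"])
      (auto simp: claims_closed_neighborhood_def closed_neighborhood_def unplayed_def grid_verts)
  then show ?thesis by simp
qed

section \<open>Staller's fast win in the S-game\<close>

text \<open>The \<open>Suc k\<close> left after \<open>u\<close> guarantees a move for completing
  the neighbourhood at \<open>c\<close> if Dominator ignores the threat.\<close>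

lemma staller_wins_threat:
  assumes "pair_graph G" "v \<in> pverts G" "closed_neighborhood G v \<inter> D = {}"
    and "closed_neighborhood G v \<subseteq> insert c (insert u S)"
    and "u \<in> unplayed G D S" "c \<in> unplayed G D S" "c \<noteq> u"
    and "staller_wins G Staller (Suc k) (insert c D) (insert u S)"
  shows "staller_wins G Staller (Suc (Suc k)) D S"
proof (rule staller_wins.staller_move)
  note ndom = not_dominating_setI[OF assms(1,2)]
  show "\<not> dominating_set G D"
    using ndom assms(3) .
  show "staller_wins G Dominator (Suc k) D (insert u S)"
  proof (rule staller_wins.dominator_move)
    show "\<forall>w\<in>unplayed G D (insert u S). staller_wins G Staller (Suc k) (insert w D) (insert u S)"
    proof
      fix w assume w: "w \<in> unplayed G D (insert u S)"
      show "staller_wins G Staller (Suc k) (insert w D) (insert u S)"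
      proof (cases "w = c")
        case False
        have "closed_neighborhood G v \<inter> insert w D = {}"
          using assms(3,4) w False by (auto simp: unplayed_def)
        then show ?thesis
          using assms(2,4,6,7) False
          by (intro staller_wins.staller_move[of _ _ c] staller_wins.won ndom)
            (auto simp: unplayed_def claims_closed_neighborhood_def)
      qed (use assms(8) in simp)
    qed
  qed (use ndom assms(3) in simp)
qed fact

text \<open>\<open>J\<close> holds the columns still to be played in row 0. As \<open>(0, 0)\<close>
  is Staller's, \<open>(0, j)\<close> forces the answer \<open>(1, j)\<close>, which never harms the
  neighbourhood of \<open>(0, 0)\<close>; the last move, \<open>(1, 0)\<close>, completes
  it.\<close>

lemma staller_wins_forcing:
  assumes "finite J" "J \<subseteq> {1..n}" "(0, 0) \<in> S" "(1, 0) \<notin> S" "(1, 0) \<notin> D"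
    and "D \<inter> {0} \<times> {..n} = {}" "{0} \<times> ({1..n} - J) \<subseteq> S"
    and "\<And>j. j \<in> J \<Longrightarrow> (0, j) \<notin> S \<and> (1, j) \<notin> D \<union> S"
  shows "staller_wins (grid n) Staller (Suc (card J)) D S"
  using assms
proof (induction arbitrary: D S rule: finite_induct)
  case empty
  have "(0, i) \<in> S" if "i \<le> n" for i
    using empty.prems(2,6) that by (cases "i = 0") auto
  then have "claims_closed_neighborhood (grid n) (insert (1, 0) S)"
    unfolding claims_closed_neighborhood_def
    by (intro bexI[of _ "(0, 0)"]) (auto simp: nbhds grid_verts)
  moreover have "\<not> dominating_set (grid n) D"
    using empty.prems
    by (intro not_dominating_setI[OF pair_graph_grid, of "(0, 0)"]) (auto simp: nbhds grid_verts)
  ultimately show ?case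
    using empty.prems
    by (intro staller_wins.staller_move[of _ _ "(1, 0)"] staller_wins.won)
      (auto simp: unplayed_def grid_verts)
next
  case (insert j J)
  have j: "1 \<le> j" "j \<le> n" "(0, j) \<notin> D \<union> S" "(1, j) \<notin> D \<union> S"
    using insert.prems by auto
  have "staller_wins (grid n) Staller (Suc (card J)) (insert (1, j) D) (insert (0, j) S)"
    using insert.prems insert.hyps by (intro insert.IH) auto
  then have "staller_wins (grid n) Staller (Suc (Suc (card J))) D S"
    using insert.prems(2,4,5) j
    by (intro staller_wins_threat[OF pair_graph_grid, where v = "(0, j)" and u = "(0, j)" and c = "(1, j)"])
      (auto simp: nbhds grid_verts unplayed_def)
  then show ?case
    using insert.hyps by simp
qed

lemma free_column:
  assumes "finite A" "card A < n"
  obtains j where "1 \<le> j" "j \<le> n" "j \<notin> snd ` A"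
proof -
  have "card (snd ` A) < card {1..n}"
    using assms card_image_le[OF assms(1), of snd] by simp
  then have "\<not> {1..n} \<subseteq> snd ` A"
    using card_mono[of "snd ` A" "{1..n}"] assms(1) by auto
  then obtain j where "j \<in> {1..n}" "j \<notin> snd ` A"
    by blast
  then show thesis
    using that[of j] by simp
qed

text \<open>\<open>(1, j)\<close> leaves the neighbourhoods of \<open>(0, j)\<close> and
  \<open>(2, j)\<close> one vertex short each, and Dominator can stop only one. Two moves suffice;
  \<open>k\<close> is slack.\<close>

lemma staller_wins_double_threat:
  assumes "1 \<le> j" "j \<le> n" "(0, 0) \<in> S" "(2, 0) \<in> S" "S \<inter> D = {}" "j \<notin> snd ` (D \<union> S)"
  shows "staller_wins (grid n) Staller (Suc (Suc k)) D S"
proof -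
  have j: "(r, j) \<notin> D" "(r, j) \<notin> S" for r
    using assms(6) by force+
  have "staller_wins (grid n) Staller (Suc k) (insert (0, j) D) (insert (1, j) S)"
  proof (rule staller_wins.staller_move[of _ _ "(2, j)"])
    show "\<not> dominating_set (grid n) (insert (0, j) D)"
      using assms(1-5) j
      by (intro not_dominating_setI[OF pair_graph_grid, of "(2, j)"]) (auto simp: nbhds grid_verts)
    show "staller_wins (grid n) Dominator k (insert (0, j) D) (insert (2, j) (insert (1, j) S))"
      using assms(1-5)
      by (intro staller_wins.won, unfold claims_closed_neighborhood_def, intro bexI[of _ "(2, j)"])
        (auto simp: nbhds grid_verts)
  qed (use assms(2) j in \<open>auto simp: unplayed_def grid_verts\<close>)
  then show ?thesis
    using assms(1-5) j
    by (intro staller_wins_threat[OF pair_graph_grid, where v = "(0, j)" and u = "(1, j)" and c = "(0, j)"])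
      (auto simp: nbhds unplayed_def grid_verts)
qed

lemma not_dominating_free_column:
  assumes "1 \<le> j" "j \<le> n" "(0, 0) \<notin> D" "j \<notin> snd ` D"
  shows "\<not> dominating_set (grid n) D"
proof -
  have "(r, j) \<notin> D" for r
    using assms(4) by force
  then show ?thesis
    using assms
    by (intro not_dominating_setI[OF pair_graph_grid, of "(0, j)"]) (auto simp: nbhds grid_verts)
qed

lemma staller_wins_grid:
  assumes "n \<ge> 3"
  shows "staller_wins (grid n) Staller (n + 2) {} {}"
proof -
  have ndom: "\<not> dominating_set (grid n) D" if "finite D" "card D < n" "(0, 0) \<notin> D" for D
    using free_column[OF that(1,2)] not_dominating_free_column that(3) by metis
  have "staller_wins (grid n) Staller (Suc n) {w} {(0, 0)}"
    if w: "w \<in> unplayed (grid n) {} {(0, 0)}" for w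
  proof (cases "w = (2, 0)")
    case True
    then show ?thesis
      using staller_wins_forcing[of "{1..n}" n "{(0, 0)}" "{(2, 0)}"] by simp
  next
    case False
    have w00: "w \<noteq> (0, 0)"
      using w by (simp add: unplayed_def)
    \<comment> \<open>Staller has taken the other outer centre \<open>(2, 0)\<close>. Two vertices
      of Dominator cannot touch all n \<ge> 3 columns, so a double threat is available.\<close>
    have "staller_wins (grid n) Staller n {w', w} {(2, 0), (0, 0)}"
      if w': "w' \<in> unplayed (grid n) {w} {(2, 0), (0, 0)}" for w'
    proof -
      have "card {w', w} < n"
        using assms by (simp add: card_insert_if)
      then obtain j where "1 \<le> j" "j \<le> n" "j \<notin> snd ` {w', w}"
        using free_column[of "{w', w}"] by blast
      then have "staller_wins (grid n) Staller (Suc (Suc (n - 2))) {w', w} {(2, 0), (0, 0)}"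
        using w' w00 False by (intro staller_wins_double_threat) (auto simp: unplayed_def)
      then show ?thesis
        using assms by (simp add: Suc_diff_Suc numeral_2_eq_2)
    qed
    then have "staller_wins (grid n) Dominator n {w} {(2, 0), (0, 0)}"
      using ndom[of "{w}"] assms w00 by (intro staller_wins.dominator_move) auto
    then show ?thesis
      using ndom[of "{w}"] assms w00 False
      by (intro staller_wins.staller_move[of _ _ "(2, 0)"]) (auto simp: unplayed_def grid_verts)
  qed
  then have "staller_wins (grid n) Dominator (Suc n) {} {(0, 0)}"
    using ndom[of "{}"] assms by (intro staller_wins.dominator_move) auto
  then have "staller_wins (grid n) Staller (Suc (Suc n)) {} {}"
    using ndom[of "{}"] assms
    by (intro staller_wins.staller_move[of _ _ "(0, 0)"]) (auto simp: unplayed_def grid_verts)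
  then show ?thesis by simp
qed

subsection \<open>Lower bounds\<close>

text \<open>\<open>(p, 0)\<close> settles row \<open>p\<close> and \<open>(1, 0)\<close>, and the
  pairs \<open>{(q, i), (1, i)}\<close> settle all other vertices except \<open>(q, 0)\<close>. Its
  neighbourhood has n + 2 vertices, at least n + 1 of them not yet Staller's, too many for
  \<open>k\<close> moves.\<close>

lemma not_staller_wins_grid_row:
  assumes "p = 0 \<and> q = 2 \<or> p = 2 \<and> q = 0" "u \<noteq> (p, 0)" "u \<notin> {q, 1} \<times> {1..n}" "k \<le> n"
  shows "\<not> staller_wins (grid n) Staller k {(p, 0)} {u}"
proof (rule not_staller_wins_pairing[OF pair_graph_grid])
  let ?T = "(\<lambda>i. {(q, i), (1, i)}) ` {1..n}"
  show "disjoint ?T"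
    using assms(1) by (auto simp: disjoint_def)
  show "closed_neighborhood (grid n) v \<inter> {(p, 0)} \<noteq> {} \<or>
      (\<exists>t\<in>?T. t \<subseteq> closed_neighborhood (grid n) v) \<or>
      k < card (closed_neighborhood (grid n) v - {u})" if "v \<in> pverts (grid n)" for v
    using that
  proof (cases rule: grid_vertex_cases)
    case (outer_center r)
    show ?thesis
    proof (cases "r = p")
      case True
      then show ?thesis
        using assms(1) outer_center by (auto simp: nbhds)
    next
      case False
      have "card (closed_neighborhood (grid n) v) = n + 2"
        using outer_center by (subst outer_center(1), subst nbhd_outer_center) (auto simp: card_insert_if)
      then show ?thesis
        using assms(4) card_Diff1_le[of "closed_neighborhood (grid n) v" u]
        by (simp add: card_Diff_singleton_if)
    qed
  qed (use assms(1) in \<open>auto simp: nbhds\<close>)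
  show "t \<subseteq> unplayed (grid n) {(p, 0)} {u}" if "t \<in> ?T" for t
    using that assms by (auto simp: grid_verts unplayed_def)
  show "\<not> t \<subseteq> {v}" if "t \<in> ?T" for t v
    using that assms(1) by fastforce
qed (use assms in \<open>auto simp: grid_verts\<close>)

text \<open>Staller's \<open>(1, i)\<close> breaks the usual pair of column \<open>i\<close>. Two
  others replace it: \<open>{(2, i), (2, 0)}\<close> guards \<open>(2, i)\<close> and
  \<open>{(0, i), (1, 0)}\<close> guards \<open>(1, i)\<close>.\<close>

lemma not_staller_wins_grid_middle:
  assumes "0 < i" "i \<le> n" "k \<le> n"
  shows "\<not> staller_wins (grid n) Staller k {(0, 0)} {(1, i)}"
proof (rule not_staller_wins_pairing[OF pair_graph_grid])
  let ?T = "insert {(2, i), (2, 0)} (insert {(0, i), (1, 0)}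
    ((\<lambda>j. {(2, j), (1, j)}) ` ({1..n} - {i}))) :: (nat \<times> nat) set set"
  show "disjoint ?T"
    using assms(1) by (auto simp: disjoint_def)
  show "closed_neighborhood (grid n) v \<inter> {(0, 0)} \<noteq> {} \<or>
      (\<exists>t\<in>?T. t \<subseteq> closed_neighborhood (grid n) v) \<or>
      k < card (closed_neighborhood (grid n) v - {(1, i)})" if "v \<in> pverts (grid n)" for v
    using that
  proof (cases rule: grid_vertex_cases)
    case (outer r j)
    then show ?thesis
      by (cases "j = i") (auto simp: nbhds)
  next
    case (middle j)
    then show ?thesis
      by (cases "j = i") (auto simp: nbhds)
  next
    case (outer_center r)
    have "card (closed_neighborhood (grid n) v) = n + 2"
      using outer_center by (subst outer_center(1), subst nbhd_outer_center) (auto simp: card_insert_if)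
    then show ?thesis
      using assms(3) by (simp add: card_Diff_singleton_if)
  qed (auto simp: nbhds)
  show "t \<subseteq> unplayed (grid n) {(0, 0)} {(1, i)}" if "t \<in> ?T" for t
    using that assms by (auto simp: grid_verts unplayed_def)
  show "\<not> t \<subseteq> {v}" if "t \<in> ?T" for t v
    using that assms(1) by fastforce
qed (use assms in \<open>auto simp: grid_verts\<close>)

lemma not_staller_wins_grid:
  assumes "k < n + 2"
  shows "\<not> staller_wins (grid n) Staller k {} {}"
proof
  assume "staller_wins (grid n) Staller k {} {}"
  then obtain u k' where u: "u \<in> pverts (grid n)" "k = Suc k'" "staller_wins (grid n) Dominator k' {} {u}"
    by cases (simp_all add: claims_closed_neighborhood_def closed_neighborhood_def unplayed_def)
  have k': "k' \<le> n"
    using u(2) assms by simp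
  have "\<not> claims_closed_neighborhood (grid n) {u}"
  proof
    assume "claims_closed_neighborhood (grid n) {u}"
    then obtain v where v: "v \<in> pverts (grid n)" "closed_neighborhood (grid n) v \<subseteq> {u}"
      by (auto simp: claims_closed_neighborhood_def)
    from v(1) show False
      using v(2) by (cases rule: grid_vertex_cases) (fastforce simp: nbhds)+
  qed
  then have reply: "staller_wins (grid n) Staller k' {c} {u}" if "c \<in> pverts (grid n)" "c \<noteq> u" for c
    using u(3) that by (auto simp: unplayed_def elim: staller_wins.cases)
  \<comment> \<open>Dominator answers a leaf move in an outer row at the centre of that row, an
    outer centre at the opposite one, and a move in row 1 at \<open>(0, 0)\<close>. The term
    \<open>2 - r\<close> denotes the opposite outer row.\<close>
  from u(1) show False
  proof (cases rule: grid_vertex_cases)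
    case (outer r i)
    then show False
      using reply[of "(r, 0)"] not_staller_wins_grid_row[of r "2 - r" u n k'] k'
      by (auto simp: grid_verts)
  next
    case (middle i)
    then show False
      using reply[of "(0, 0)"] not_staller_wins_grid_middle[of i n k'] k'
      by (auto simp: grid_verts)
  next
    case (outer_center r)
    then show False
      using reply[of "(2 - r, 0)"] not_staller_wins_grid_row[of "2 - r" r u n k'] k'
      by (auto simp: grid_verts)
  next
    case center
    then show False
      using reply[of "(0, 0)"] not_staller_wins_grid_row[of 0 2 u n k'] k'
      by (auto simp: grid_verts)
  qed
qed

section \<open>Staller's delaying play in the D-game\<close>

lemma dominator_needs_0: "dominator_needs G p 0 D S"
  by (simp add: dominator_needs_def)

text \<open>Each \<open>(p, j)\<close> forces the answer \<open>(1, j)\<close>. These answers leave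
  \<open>(p, 0)\<close> undominated, which costs Dominator one more move.\<close>

lemma dominator_needs_forcing:
  assumes "finite J" "J \<subseteq> {1..n}" "p = 0 \<or> p = 2" "(p, 0) \<in> S"
    and "D \<inter> insert (1, 0) ({p} \<times> {..n}) = {}"
    and "\<And>j. j \<in> J \<Longrightarrow> (p, j) \<notin> S \<and> (1, j) \<notin> D \<union> S"
  shows "dominator_needs (grid n) Staller (Suc (card J)) D S"
  using assms
proof (induction arbitrary: D S rule: finite_induct)
  case empty
  have "dominator_needs (grid n) Staller (card {(p, 0::nat)}) D S"
    using empty.prems by (intro dominator_needs_disjoint[OF pair_graph_grid]) (auto simp: nbhds grid_verts)
  then show ?case by simp
next
  case (insert j J)
  have j: "1 \<le> j" "j \<le> n" "(p, 0) \<notin> D" "(p, j) \<notin> D" "(1, j) \<notin> D" "(p, j) \<notin> S" "(1, j) \<notin> S"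
    using insert.prems by auto
  have p: "p \<le> 2" "p \<noteq> 1"
    using insert.prems(2) by auto
  have "dominator_needs (grid n) Staller (Suc (card J)) (insert (1, j) D) (insert (p, j) S)"
    using insert.prems insert.hyps by (intro insert.IH) auto
  then have "dominator_needs (grid n) Staller (Suc (Suc (card J))) D S"
    using insert.prems(3) j p
    by (intro dominator_needs_threat[OF pair_graph_grid, where v = "(p, j)" and u = "(p, j)" and c = "(1, j)"
        and m = "Suc (card J)"]) (auto simp: nbhd_outer[OF insert.prems(2)] grid_verts unplayed_def)
  then show ?case
    using insert.hyps by simp
qed

text \<open>The neighbourhoods of the vertices \<open>(p, i)\<close> meet only in Staller's
  \<open>(p, 0)\<close>, so the counting bound applies; in the next lemma \<open>(1, 0)\<close> has
  this role.\<close>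

lemma dominator_needs_outer:
  assumes "I \<subseteq> {1..n}" "p = 0 \<or> p = 2" "(p, 0) \<in> S" "(p, 0) \<notin> D"
    and "\<And>i. i \<in> I \<Longrightarrow> (p, i) \<notin> D \<and> (1, i) \<notin> D"
  shows "dominator_needs (grid n) pl (card I) D S"
proof -
  have nbhd: "closed_neighborhood (grid n) (p, i) = {(p, i), (1, i), (p, 0)}" "i \<le> n" if "i \<in> I" for i
    using that assms(1,2) nbhd_outer[of p i n] by auto
  have "finite I" "p \<le> 2"
    using assms(1,2) finite_subset by auto
  then have "dominator_needs (grid n) pl (card (Pair p ` I)) D S"
    using assms(3-5) \<open>p \<le> 2\<close>
    by (intro dominator_needs_disjoint[OF pair_graph_grid]) (auto simp: nbhd grid_verts)
  then show ?thesis
    by (subst (asm) card_image) (auto simp: inj_on_def)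
qed

lemma dominator_needs_middle:
  assumes "I \<subseteq> {1..n}" "(1, 0) \<in> S" "(1, 0) \<notin> D" "I \<inter> snd ` D = {}"
  shows "dominator_needs (grid n) pl (card I) D S"
proof -
  have D: "(r, i) \<notin> D" if "i \<in> I" for r i
    using assms(4) that by force
  have nbhd: "closed_neighborhood (grid n) (1, i) = {(0, i), (1, i), (2, i), (1, 0)}" "i \<le> n" if "i \<in> I" for i
    using that assms(1) nbhd_middle[of i n] by auto
  have "finite I"
    using assms(1) finite_subset by blast
  then have "dominator_needs (grid n) pl (card (Pair (1 :: nat) ` I)) D S"
    using assms(2,3) D
    by (intro dominator_needs_disjoint[OF pair_graph_grid])
      (auto simp: nbhd[unfolded One_nat_def] grid_verts)
  then show ?thesis
    by (subst (asm) card_image) (auto simp: inj_on_def)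
qed

text \<open>
  Here \<open>(p, 0)\<close> and \<open>(1, 0)\<close> are both free. Staller plays \<open>(p, j)\<close>; an answer at one of these two centres
  is met at the other one, which leaves one move to be made by Dominator in every remaining column.
\<close>

lemma dominator_needs_reserve:
  assumes "finite J" "J \<subseteq> {1..n}" "p = 0 \<or> p = 2" "(p, 0) \<notin> S" "(1, 0) \<notin> S"
    and "D \<inter> insert (1, 0) ({p} \<times> {..n}) = {}" "J \<inter> snd ` D = {}"
    and "\<And>j. j \<in> J \<Longrightarrow> (p, j) \<notin> S \<and> (1, j) \<notin> S"
  shows "dominator_needs (grid n) Staller (Suc (card J)) D S"
  using assms
proof (induction arbitrary: D S rule: finite_induct)
  case empty
  have "dominator_needs (grid n) Staller (card {(p, 0::nat)}) D S"
    using empty.prems by (intro dominator_needs_disjoint[OF pair_graph_grid]) (auto simp: nbhds grid_verts)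
  then show ?case by simp
next
  case (insert j J)
  have jJ: "1 \<le> j" "j \<le> n" "insert j J \<subseteq> {1..n}" "J \<subseteq> {1..n}"
    using insert.prems by auto
  have D: "(r, i) \<notin> D" if "i \<in> insert j J" for r i
    using insert.prems(6) that by force
  have centers: "(p, 0) \<notin> D" "(1, 0) \<notin> D"
    using insert.prems(5) by auto
  have jS: "(p, j) \<notin> S" "(1, j) \<notin> S"
    using insert.prems(7)[of j] by auto
  have card: "card (insert j J) = Suc (card J)"
    using insert.hyps by simp
  have "dominator_needs (grid n) Staller (Suc (card J)) (insert w D) (insert (p, j) S)"
    if w: "w \<in> unplayed (grid n) D (insert (p, j) S)" for w
  proof -
    consider "w = (1, j)" | "w = (p, 0)" | "w = (1, 0)" | "w \<notin> {(1, j), (p, 0), (1, 0)}"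
      by blast
    then show ?thesis
    proof cases
      \<comment> \<open>The column is settled by one move and both centres are still free, so the
        induction goes on.\<close>
      case 1
      have "J \<inter> snd ` insert (1, j) D = {}"
        using insert.prems(6) insert.hyps(2) by auto
      then show ?thesis
        unfolding 1 using insert.prems(1-5,7) insert.hyps(2) by (intro insert.IH) auto
    next
      case 2
      have "insert j J \<inter> snd ` insert (p, 0) D = {}"
        using insert.prems(6) jJ by auto
      then have "dominator_needs (grid n) Dominator (card (insert j J)) (insert (p, 0) D)
          (insert (1, 0) (insert (p, j) S))"
        using jJ centers insert.prems(2) by (intro dominator_needs_middle) auto
      then show ?thesis
        unfolding 2 card using jJ centers D[of j] insert.prems(2,4)
        by (intro dominator_needs_staller_move[OF pair_graph_grid, where v = "(1, j)" and u = "(1, 0)"])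
          (auto simp: nbhds grid_verts unplayed_def)
    next
      case 3
      have "dominator_needs (grid n) Dominator (card (insert j J)) (insert (1, 0) D)
          (insert (p, 0) (insert (p, j) S))"
        using jJ centers D insert.prems(2) by (intro dominator_needs_outer[where p = p]) auto
      then show ?thesis
        unfolding 3 card using jJ centers D[of j] insert.prems(2,3)
        by (intro dominator_needs_staller_move[OF pair_graph_grid, where v = "(p, j)" and u = "(p, 0)"])
          (auto simp: nbhds grid_verts unplayed_def)
    next
      \<comment> \<open>Staller plays \<open>(1, j)\<close>, which forces \<open>(p, 0)\<close>, and
        then takes \<open>(1, 0)\<close>.\<close>
      case 4
      let ?D = "insert (p, 0) (insert w D)" and ?S = "insert (1, j) (insert (p, j) S)"
      have "dominator_needs (grid n) Staller (card J) ?D ?S"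
      proof (cases "J = {}")
        case False
        \<comment> \<open>At most one column of \<open>insert j J\<close> is spoiled by
          \<open>w\<close>; removing it, or \<open>j\<close> if \<open>w\<close> is not in a column
          of \<open>J\<close>, leaves exactly \<open>card J\<close> untouched columns.\<close>
        define I where "I = insert j J - {if snd w \<in> J then snd w else j}"
        have I: "card I = card J" "I \<subseteq> {1..n}" "I \<inter> snd ` ?D = {}"
          using insert.hyps insert.prems(6) jJ
          by (auto simp: I_def card_insert_if card_Diff_singleton_if card_gt_0_iff split: if_splits)
        then obtain i where i: "i \<in> I"
          using False insert.hyps(1) by fastforce
        have iD: "(r, i) \<notin> ?D" for r
          using I(3) i by force
        have in_range: "1 \<le> i" "i \<le> n"
          using I(2) i by auto
        have "dominator_needs (grid n) Dominator (card I) ?D (insert (1, 0) ?S)"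
          using I jJ centers insert.prems(2) 4 by (intro dominator_needs_middle) auto
        then show ?thesis
          unfolding I(1) using iD in_range jJ centers 4 insert.prems(2,4)
          by (intro dominator_needs_staller_move[OF pair_graph_grid, where v = "(1, i)" and u = "(1, 0)"])
            (auto simp: nbhds grid_verts unplayed_def)
      qed (simp add: dominator_needs_0)
      then show ?thesis
        using jJ centers jS D[of j] 4 w insert.prems(2,3)
        by (intro dominator_needs_threat[OF pair_graph_grid, where v = "(p, j)" and u = "(1, j)" and c = "(p, 0)"])
          (auto simp: nbhds grid_verts unplayed_def)
    qed
  qed
  then have "dominator_needs (grid n) Dominator (Suc (Suc (card J))) D (insert (p, j) S)"
    using jJ centers D[of j] insert.prems(2)
    by (intro dominator_needs_dominator_move[OF pair_graph_grid, where v = "(p, j)"])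
      (auto simp: nbhds grid_verts)
  then show ?case
    unfolding card using jJ centers D[of j] jS insert.prems(2)
    by (intro dominator_needs_staller_move[OF pair_graph_grid, where v = "(p, j)" and u = "(p, j)"])
      (auto simp: nbhds grid_verts unplayed_def)
qed

text \<open>The double threat at \<open>(1, j)\<close> wins for Staller, so \<open>m\<close> is
  arbitrary.\<close>

lemma dominator_needs_double_threat:
  assumes "1 \<le> j" "j \<le> n" "(0, 0) \<in> S" "(2, 0) \<in> S" "S \<inter> D = {}" "j \<notin> snd ` (D \<union> S)"
  shows "dominator_needs (grid n) Staller m D S"
proof -
  have j: "(r, j) \<notin> D" "(r, j) \<notin> S" for r
    using assms(6) by force+
  have "dominator_needs (grid n) Dominator m (insert (0, j) D) (insert (2, j) (insert (1, j) S))"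
    using assms(1-5) j
    by (intro dominator_needs_claimed[OF pair_graph_grid, of "(2, j)"]) (auto simp: nbhds grid_verts)
  then have "dominator_needs (grid n) Staller m (insert (0, j) D) (insert (1, j) S)"
    using assms(1-5) j
    by (intro dominator_needs_staller_move[OF pair_graph_grid, where v = "(2, j)" and u = "(2, j)"])
      (auto simp: nbhds grid_verts unplayed_def)
  then have "dominator_needs (grid n) Staller (Suc m) D S"
    using assms(1-5) j
    by (intro dominator_needs_threat[OF pair_graph_grid, where v = "(0, j)" and u = "(1, j)" and c = "(0, j)"])
      (auto simp: nbhds unplayed_def grid_verts)
  then show ?thesis
    by (rule dominator_needs_mono) simp
qed

text \<open>Covers the case left over by the double threat, where Dominator has one vertex in each
  column. The argument splits by how many of them lie outside row 1.\<close>

lemma dominator_needs_transversal: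
  assumes "n \<ge> 1" "S = {(0, 0), (2, 0)}" "D \<subseteq> {..2} \<times> UNIV" "inj_on snd D" "snd ` D = {1..n}"
  shows "dominator_needs (grid n) Staller 2 D S"
proof -
  have col: "r = s" if "(r, i) \<in> D" "(s, i) \<in> D" for r s i
    using inj_onD[OF assms(4) _ that] by simp
  have range: "1 \<le> i" "i \<le> n" "r \<le> 2" if "(r, i) \<in> D" for r i
    using that assms(3,5) by force+
  consider (none) "D \<subseteq> {1} \<times> UNIV"
    | (one) r i where "(r, i) \<in> D" "r \<noteq> 1" "D - {(r, i)} \<subseteq> {1} \<times> UNIV"
    | (two) r i s j where "(r, i) \<in> D" "r \<noteq> 1" "(s, j) \<in> D" "s \<noteq> 1" "(r, i) \<noteq> (s, j)"
    by fastforce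
  then show ?thesis
  proof cases
    \<comment> \<open>Both outer centres are undominated, and once Staller has
      \<open>(1, 0)\<close>, no single vertex dominates both.\<close>
    case none
    have "(0, k) \<notin> D" "(2, k) \<notin> D" "(k, 0) \<notin> D" for k
      using none range(1)[of k 0] by auto
    note D = this
    have "closed_neighborhood (grid n) (0, 0) \<inter> D = {}" "closed_neighborhood (grid n) (2, 0) \<inter> D = {}"
      using D by (auto simp: nbhds)
    note nbhds_D = this
    have "dominator_needs (grid n) Dominator (card {(0, 0), (2, 0) :: nat \<times> nat}) D (insert (1, 0) S)"
    proof (rule dominator_needs_disjoint[OF pair_graph_grid])
      show "closed_neighborhood (grid n) v \<inter> closed_neighborhood (grid n) w \<subseteq> insert (1, 0) S"
        if "v \<in> {(0, 0), (2, 0)}" "w \<in> {(0, 0), (2, 0)}" "v \<noteq> w" for v w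
        using that by (auto simp: nbhds)
    qed (use nbhds_D in \<open>auto simp: grid_verts\<close>)
    then have "dominator_needs (grid n) Dominator 2 D (insert (1, 0) S)"
      by (simp add: numeral_2_eq_2)
    then show ?thesis
      using D(3)[of 1] assms(2)
      by (intro dominator_needs_staller_move[OF pair_graph_grid _ nbhds_D(1), where u = "(1, 0)"])
        (auto simp: grid_verts unplayed_def)
  next
    \<comment> \<open>Row \<open>2 - r\<close> is free of Dominator: Staller forces
      \<open>(1, i)\<close> there, and \<open>(2 - r, 0)\<close> still needs a move.\<close>
    case one
    have r: "2 - r = 0 \<or> 2 - r = 2" "2 - r \<noteq> r"
      using one(2) range(3)[OF one(1)] by auto
    have "(1, i) \<notin> D"
      using col[OF one(1)] one(2) by blast
    moreover have "(2 - r, k) \<notin> D" for k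
      using one(3) r by auto
    ultimately have "dominator_needs (grid n) Staller (Suc (card {i})) D S"
      using one r range[OF one(1)] range assms(2)
      by (intro dominator_needs_forcing[where p = "2 - r"]) (auto dest: range)
    then show ?thesis by (simp add: numeral_2_eq_2)
  next
    \<comment> \<open>In each of the two columns the vertex opposite to Dominator's is undominated,
      and their neighbourhoods share at most an outer centre owned by Staller.\<close>
    case two
    let ?F = "{(2 - r, i), (2 - s, j)}"
    have ij: "i \<noteq> j"
      using col[of r i s] two by auto
    have r: "2 - r = 0 \<or> 2 - r = 2" "2 - r \<noteq> r" "2 - s = 0 \<or> 2 - s = 2" "2 - s \<noteq> s"
      using two(2,4) range(3)[OF two(1)] range(3)[OF two(3)] by auto
    have "(1, i) \<notin> D" "(2 - r, i) \<notin> D" "(1, j) \<notin> D" "(2 - s, j) \<notin> D"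
      using col[OF two(1)] col[OF two(3)] two(2,4) r by metis+
    moreover have "(k, 0) \<notin> D" for k
      using range(1)[of k 0] by auto
    ultimately have "dominator_needs (grid n) Staller (card ?F) D S"
      using ij r range[OF two(1)] range[OF two(3)] assms(2)
      by (intro dominator_needs_disjoint[OF pair_graph_grid]) (auto simp: nbhds grid_verts)
    then show ?thesis
      using ij by (simp add: numeral_2_eq_2)
  qed
qed

text \<open>Staller takes \<open>(p, 0)\<close>. If Dominator answers \<open>(q, 0)\<close>, forcing
  or counting in row \<open>p\<close> gives the bound; otherwise Staller takes \<open>(q, 0)\<close>
  as well.\<close>

lemma dominator_needs_reply:
  assumes "n \<ge> 3" "p = 0 \<and> q = 2 \<or> p = 2 \<and> q = 0"
    and "u \<in> pverts (grid n)" "u \<notin> {p} \<times> {..n}" "u \<noteq> (q, 0)"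
  shows "dominator_needs (grid n) Staller (Suc n) {u} {}"
proof -
  have undominated: "\<exists>v\<in>pverts (grid n). closed_neighborhood (grid n) v \<inter> D = {}"
    if D: "finite D" "card D < n" "(p, 0) \<notin> D" for D
  proof -
    obtain j where j: "1 \<le> j" "j \<le> n" "j \<notin> snd ` D"
      using free_column[OF D(1,2)] .
    have "(r, j) \<notin> D" for r
      using j(3) by force
    then show ?thesis
      using j(1,2) assms(2) D(3) by (intro bexI[of _ "(p, j)"]) (auto simp: nbhds grid_verts)
  qed
  have up: "u \<noteq> (p, 0)"
    using assms(4) by auto
  have "dominator_needs (grid n) Staller n {w, u} {(p, 0)}"
    if w: "w \<in> unplayed (grid n) {u} {(p, 0)}" for w
  proof (cases "w = (q, 0)")
    case True
    show ?thesis
    proof (cases "u = (1, 0)")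
      case u: True
      have "dominator_needs (grid n) Staller (card {1..n}) {(q, 0), (1, 0)} {(p, 0)}"
        using assms(2) by (intro dominator_needs_outer[where p = p]) auto
      then show ?thesis
        unfolding True u by simp
    next
      case False
      \<comment> \<open>The column of \<open>u\<close> is left out because \<open>u\<close> may be
        its middle vertex; the extra move for \<open>(p, 0)\<close> makes up for it.\<close>
      have "dominator_needs (grid n) Staller (Suc (card ({1..n} - {snd u}))) {(q, 0), u} {(p, 0)}"
        using assms False by (intro dominator_needs_forcing[where p = p]) auto
      then show ?thesis
        unfolding True by (rule dominator_needs_mono) (simp add: card_Diff_singleton_if)
    qed
  next
    case False
    let ?S = "{(q, 0), (p, 0)}"
    have wp: "w \<noteq> (p, 0)" and card: "card {w, u} < n"
      using w assms(1) by (auto simp: unplayed_def card_insert_if)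
    obtain v where v: "v \<in> pverts (grid n)" "closed_neighborhood (grid n) v \<inter> {w, u} = {}"
      using undominated[of "{w, u}"] wp up card by auto
    have "dominator_needs (grid n) Staller (n - 1) {w', w, u} ?S"
      if w': "w' \<in> unplayed (grid n) {w, u} ?S" for w'
    proof (cases "{1..n} \<subseteq> snd ` {w', w, u}")
      case True
      have "card (snd ` {w', w, u}) \<le> card {w', w, u}" "card {w', w, u} \<le> 3"
        by (auto intro: card_image_le simp: card_insert_if)
      moreover have "n \<le> card (snd ` {w', w, u})"
        using card_mono[OF _ True] by simp
      \<comment> \<open>Three vertices touching n \<ge> 3 columns force equality throughout: n is 3,
        and every column contains exactly one of them.\<close>
      ultimately have n: "n = 3" "card (snd ` {w', w, u}) = card {1..n}"
          "card (snd ` {w', w, u}) = card {w', w, u}"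
        using assms(1) by auto
      have "dominator_needs (grid n) Staller 2 {w', w, u} ?S"
      proof (rule dominator_needs_transversal)
        show "snd ` {w', w, u} = {1..n}"
          using card_subset_eq[OF _ True] n(2) by simp
        show "inj_on snd {w', w, u}"
          using n(3) by (intro eq_card_imp_inj_on) simp_all
        show "?S = {(0, 0), (2, 0)}"
          using assms(2) by auto
        show "{w', w, u} \<subseteq> {..2} \<times> UNIV"
          using assms(3) w w' by (auto simp: unplayed_def grid_verts)
      qed (use assms(1) in simp)
      then show ?thesis
        using n(1) by simp
    next
      case False
      then obtain j where "1 \<le> j" "j \<le> n" "j \<notin> snd ` {w', w, u}"
        by (meson atLeastAtMost_iff subsetI)
      then show ?thesis
        using assms(2,5) up wp \<open>w \<noteq> (q, 0)\<close> w'
        by (intro dominator_needs_double_threat[of j]) (auto simp: unplayed_def)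
    qed
    then have "dominator_needs (grid n) Dominator (Suc (n - 1)) {w, u} ?S"
      by (rule dominator_needs_dominator_move[OF pair_graph_grid v])
    then show ?thesis
      using False assms by (intro dominator_needs_staller_move[OF pair_graph_grid v, of "(q, 0)"])
        (auto simp: unplayed_def grid_verts)
  qed
  moreover obtain v where v: "v \<in> pverts (grid n)" "closed_neighborhood (grid n) v \<inter> {u} = {}"
    using undominated[of "{u}"] up assms(1) by auto
  ultimately have "dominator_needs (grid n) Dominator (Suc n) {u} {(p, 0)}"
    by (intro dominator_needs_dominator_move[OF pair_graph_grid v])
  then show ?thesis
    using assms(2) up by (intro dominator_needs_staller_move[OF pair_graph_grid v, of "(p, 0)"])
      (auto simp: unplayed_def grid_verts)
qed

lemma dominator_needs_grid:
  assumes "n \<ge> 3"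
  shows "dominator_needs (grid n) Dominator (n + 2) {} {}"
proof -
  have "dominator_needs (grid n) Staller (Suc n) {u} {}"
    if "u \<in> pverts (grid n)" for u
    using that
  proof (cases rule: grid_vertex_cases)
    case (outer r i)
    then show ?thesis
      using dominator_needs_reply[OF assms, of "2 - r" r u] that by auto
  next
    case (middle i)
    then show ?thesis
      using dominator_needs_reply[OF assms, of 0 2 u] that by auto
  next
    case center
    then show ?thesis
      using dominator_needs_reply[OF assms, of 0 2 u] that by auto
  next
    \<comment> \<open>After the opening \<open>(r, 0)\<close>, the opposite row, its centre and
      \<open>(1, 0)\<close> are all free, so the reserve strategy runs over all n columns.\<close>
    case (outer_center r)
    then have "dominator_needs (grid n) Staller (Suc (card {1..n})) {u} {}"
      by (intro dominator_needs_reserve[where p = "2 - r"]) auto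
    then show ?thesis by simp
  qed
  then have "dominator_needs (grid n) Dominator (Suc (Suc n)) {} {}"
    by (intro dominator_needs_dominator_move[OF pair_graph_grid, of "(0, 0)"])
      (auto simp: unplayed_def grid_verts)
  then show ?thesis by simp
qed

theorem theorem4p4:
  fixes n :: nat
  assumes "n \<ge> 3"
  shows "gamma_MB (path_graph 3 \<box> star_graph n) = enat (n + 2) \<and>
         gamma_SMB' (path_graph 3 \<box> star_graph n) = enat (n + 2)"
proof
  show "gamma_MB (grid n) = enat (n + 2)"
    unfolding gamma_MB_def
    using dominator_wins_grid dominator_needs_grid[OF assms]
    by (intro Inf_enat_eq_least) (auto simp: dominator_needs_def)
  show "gamma_SMB' (grid n) = enat (n + 2)"
    unfolding gamma_SMB'_def
    using staller_wins_grid[OF assms] not_staller_wins_grid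
    by (intro Inf_enat_eq_least) auto
qed

end
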